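(* Let $\vec U$ be a finite distributive universe of separations and let $\vec U'\subseteq\vec U$ be a subuniverse. Then there are a submodular order function $f\colon\vec U\to\mathbb R_{\ge0}$ and a $k\in\mathbb R_{\ge0}$ such that $\vec U'=f^{-1}([0,k])$.
   Context: A universe of separations is a lattice $\vec U$ equipped with an order-reversing involution ${}^*$; it is distributive if the lattice is distributive. A subuniverse of $\vec U$ is a subset closed under ${}^*$ and under joins and meets in $\vec U$. A submodular order function on $\vec U$ is a function $f\colon\vec U\to\mathbb R_{\ge0}$ with $f(r\vee s)+f(r\wedge s)\le f(r)+f(s)$ for all $r,s\in\vec U$ and $f(s)=f(s^* )$ for all $s\in\vec U$. *)

theory Defs
  imports Complex_Main
begin

text \<open>A universe of separations is a lattice (given by the type class \<open>lattice\<close> on the type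
  of separations) together with an order-reversing involution \<open>star\<close>.\<close>

locale universe_of_separations =
  fixes star :: "'a::lattice \<Rightarrow> 'a"
  assumes star_involution: "star (star s) = s"
    and star_order_reversing: "r \<le> s \<Longrightarrow> star s \<le> star r"

text \<open>Only closure is required of a subuniverse, so the empty set is one, and a subuniverse need
  not contain the least and greatest elements of the lattice.\<close>

definition subuniverse :: "('a::lattice \<Rightarrow> 'a) \<Rightarrow> 'a set \<Rightarrow> bool" where
  "subuniverse star U' \<longleftrightarrow>
     (\<forall>s\<in>U'. star s \<in> U') \<and>
     (\<forall>r\<in>U'. \<forall>s\<in>U'. sup r s \<in> U' \<and> inf r s \<in> U')"

definition submodular_order_function :: "('a::lattice \<Rightarrow> 'a) \<Rightarrow> ('a \<Rightarrow> real) \<Rightarrow> bool" where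
  "submodular_order_function star f \<longleftrightarrow>
     (\<forall>s. 0 \<le> f s) \<and>
     (\<forall>r s. f (sup r s) + f (inf r s) \<le> f r + f s) \<and>
     (\<forall>s. f s = f (star s))"

end

(* Idea: if p is sup-prime and q is inf-prime, the indicator of the interval {p..q} is submodular.
   In a finite distributive lattice the complement of a sublattice is a union of such intervals, so
   the sum of the indicators of all of those that avoid the sublattice vanishes exactly on it.
   Adding the composition of this sum with the involution makes it symmetric; then k = 0 works. *)

theory Submission
  imports Defs
begin

text \<open>A least or greatest element counts as prime. This is what makes the empty sublattice
  an instance of \<open>sublattice_complement_interval\<close>.\<close>

definition sup_prime :: "'a::lattice \<Rightarrow> bool" where
  "sup_prime p \<longleftrightarrow> (\<forall>a b. p \<le> sup a b \<longrightarrow> p \<le> a \<or> p \<le> b)"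

definition inf_prime :: "'a::lattice \<Rightarrow> bool" where
  "inf_prime q \<longleftrightarrow> (\<forall>a b. inf a b \<le> q \<longrightarrow> a \<le> q \<or> b \<le> q)"

text \<open>Primality splits \<open>p \<le> sup r s\<close> and \<open>inf r s \<le> q\<close> into
  disjunctions. If join and meet both lie in the interval, so do \<open>r\<close> and
  \<open>s\<close>. If only the join does, both elements are below \<open>q\<close> and one of them
  is above \<open>p\<close>; the case of the meet is dual.\<close>

lemma interval_indicator_submodular:
  fixes p q r s :: "'a::lattice"
  assumes "sup_prime p" "inf_prime q"
  shows "of_bool (p \<le> sup r s \<and> sup r s \<le> q) + of_bool (p \<le> inf r s \<and> inf r s \<le> q)
       \<le> (of_bool (p \<le> r \<and> r \<le> q) + of_bool (p \<le> s \<and> s \<le> q) :: real)"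
proof -
  have "p \<le> sup r s \<longleftrightarrow> p \<le> r \<or> p \<le> s"
    using assms(1) unfolding sup_prime_def by (meson le_supI1 le_supI2)
  moreover have "inf r s \<le> q \<longleftrightarrow> r \<le> q \<or> s \<le> q"
    using assms(2) unfolding inf_prime_def by (meson le_infI1 le_infI2)
  ultimately show ?thesis
    by (auto simp: of_bool_def)
qed

text \<open>In a finite distributive lattice every element is a join of sup-primes, so bounds in
  \<open>S\<close> for the sup-primes below \<open>x\<close> join to a bound for \<open>x\<close>.
  The induction is on the number of elements strictly below \<open>x\<close>.\<close>

lemma sup_closed_above:
  fixes x :: "'a::{finite, distrib_lattice}"
  assumes sup_closed: "\<And>u v. u \<in> S \<Longrightarrow> v \<in> S \<Longrightarrow> sup u v \<in> S"
    and prime: "\<And>p. sup_prime p \<Longrightarrow> p \<le> x \<Longrightarrow> \<exists>u\<in>S. p \<le> u"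
  shows "\<exists>u\<in>S. x \<le> u"
  using prime
proof (induction x rule: measure_induct_rule[of "\<lambda>x. card {..<x}"])
  case (less x)
  have step: "\<exists>u\<in>S. z \<le> u" if "z < x" for z
  proof (rule less.IH)
    have "{..<z} \<subset> {..<x}" using that by auto
    then show "card {..<z} < card {..<x}" by (simp add: psubset_card_mono)
    show "\<exists>u\<in>S. p \<le> u" if "sup_prime p" "p \<le> z" for p
      using less.prems[OF that(1)] that(2) \<open>z < x\<close> by simp
  qed
  show ?case
  proof (cases "sup_prime x")
    case True
    then show ?thesis using less.prems by blast
  next
    case False
    then obtain a b where ab: "x \<le> sup a b" "\<not> x \<le> a" "\<not> x \<le> b"
      unfolding sup_prime_def by blast
    \<comment> \<open>Neither \<open>a\<close> nor \<open>b\<close> is above \<open>x\<close>, so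
      cutting them down to \<open>x\<close> gives strictly smaller elements; by distributivity their
      join is still \<open>x\<close>.\<close>
    have "inf x a < x" "inf x b < x"
      using ab(2,3) by (metis inf.cobounded1 inf.cobounded2 order_le_less)+
    then obtain u v where "u \<in> S" "inf x a \<le> u" "v \<in> S" "inf x b \<le> v"
      using step by meson
    moreover have "x = sup (inf x a) (inf x b)"
      using ab(1) by (simp add: inf_sup_distrib1[symmetric] inf.absorb1)
    ultimately show ?thesis
      by (metis sup_closed sup_mono)
  qed
qed

text \<open>Order dual of \<open>sup_closed_above\<close>, with \<open>x\<close> as a meet of
  inf-primes.\<close>

lemma inf_closed_below:
  fixes x :: "'a::{finite, distrib_lattice}"
  assumes inf_closed: "\<And>u v. u \<in> S \<Longrightarrow> v \<in> S \<Longrightarrow> inf u v \<in> S"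
    and prime: "\<And>q. inf_prime q \<Longrightarrow> x \<le> q \<Longrightarrow> \<exists>u\<in>S. u \<le> q"
  shows "\<exists>u\<in>S. u \<le> x"
  using prime
proof (induction x rule: measure_induct_rule[of "\<lambda>x. card {x<..}"])
  case (less x)
  have step: "\<exists>u\<in>S. u \<le> z" if "x < z" for z
  proof (rule less.IH)
    have "{z<..} \<subset> {x<..}" using that by auto
    then show "card {z<..} < card {x<..}" by (simp add: psubset_card_mono)
    show "\<exists>u\<in>S. u \<le> q" if "inf_prime q" "z \<le> q" for q
      using less.prems[OF that(1)] that(2) \<open>x < z\<close> by simp
  qed
  show ?case
  proof (cases "inf_prime x")
    case True
    then show ?thesis using less.prems by blast
  next
    case False
    then obtain a b where ab: "inf a b \<le> x" "\<not> a \<le> x" "\<not> b \<le> x"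
      unfolding inf_prime_def by blast
    have "x < sup x a" "x < sup x b"
      using ab(2,3) by (metis sup.cobounded1 sup.cobounded2 order_le_less)+
    then obtain u v where "u \<in> S" "u \<le> sup x a" "v \<in> S" "v \<le> sup x b"
      using step by meson
    moreover have "x = inf (sup x a) (sup x b)"
      using ab(1) by (simp add: sup_inf_distrib1[symmetric] sup.absorb1)
    ultimately show ?thesis
      by (metis inf_closed inf_mono)
  qed
qed

text \<open>If every such interval around \<open>x\<close> met \<open>S\<close>, the two preceding
  lemmas, applied one after the other, would force \<open>x\<close> itself into
  \<open>S\<close>.\<close>

lemma sublattice_complement_interval:
  fixes x :: "'a::{finite, distrib_lattice}"
  assumes sup_closed: "\<And>u v. u \<in> S \<Longrightarrow> v \<in> S \<Longrightarrow> sup u v \<in> S"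
    and inf_closed: "\<And>u v. u \<in> S \<Longrightarrow> v \<in> S \<Longrightarrow> inf u v \<in> S"
    and "x \<notin> S"
  obtains p q where "sup_prime p" "inf_prime q" "p \<le> x" "x \<le> q" "S \<inter> {p..q} = {}"
proof (rule ccontr)
  assume "\<not> thesis"
  with that have meets: "S \<inter> {p..q} \<noteq> {}"
    if "sup_prime p" "inf_prime q" "p \<le> x" "x \<le> q" for p q
    using that by blast
  \<comment> \<open>For fixed \<open>p\<close> the part of \<open>S\<close> above \<open>p\<close>
    is closed under meets; varying \<open>q\<close> yields an element of it below
    \<open>x\<close>.\<close>
  have "\<exists>u\<in>S \<inter> {p..}. u \<le> x" if p: "sup_prime p" "p \<le> x" for p
  proof (rule inf_closed_below)
    show "\<exists>u\<in>S \<inter> {p..}. u \<le> q" if "inf_prime q" "x \<le> q" for q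
      using meets[OF p(1) that(1) p(2) that(2)] by auto
  qed (use inf_closed in auto)
  then have above: "\<exists>u\<in>S \<inter> {..x}. p \<le> u" if "sup_prime p" "p \<le> x" for p
    using that by blast
  \<comment> \<open>Now \<open>p\<close> varies, and the part of \<open>S\<close> below
    \<open>x\<close> is closed under joins. The element obtained lies both below and above
    \<open>x\<close>, so it equals \<open>x\<close>.\<close>
  have "\<exists>u\<in>S \<inter> {..x}. x \<le> u"
    by (rule sup_closed_above[OF _ above]) (simp_all add: sup_closed)
  then show False using \<open>x \<notin> S\<close> by (auto dest: antisym)
qed

lemma submodular_vanishing_on_sublattice:
  fixes S :: "'a::{finite, distrib_lattice} set"
  assumes "\<And>u v. u \<in> S \<Longrightarrow> v \<in> S \<Longrightarrow> sup u v \<in> S"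
    and "\<And>u v. u \<in> S \<Longrightarrow> v \<in> S \<Longrightarrow> inf u v \<in> S"
  obtains f :: "'a \<Rightarrow> real" where "\<And>x. 0 \<le> f x"
    and "\<And>r s. f (sup r s) + f (inf r s) \<le> f r + f s"
    and "\<And>x. f x = 0 \<longleftrightarrow> x \<in> S"
proof
  define T where "T = {(p, q). sup_prime p \<and> inf_prime q \<and> S \<inter> {p..q} = {}}"
  define f :: "'a \<Rightarrow> real" where "f x = (\<Sum>(p, q)\<in>T. of_bool (p \<le> x \<and> x \<le> q))" for x
  show "0 \<le> f x" for x
    unfolding f_def by (intro sum_nonneg) auto
  show "f (sup r s) + f (inf r s) \<le> f r + f s" for r s
    unfolding f_def sum.distrib[symmetric] case_prod_beta
    by (intro sum_mono interval_indicator_submodular) (auto simp: T_def)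
  show "f x = 0 \<longleftrightarrow> x \<in> S" for x
  proof -
    have "f x = 0 \<longleftrightarrow> (\<forall>(p, q)\<in>T. \<not> (p \<le> x \<and> x \<le> q))"
      unfolding f_def by (subst sum_nonneg_eq_0_iff) auto
    also have "\<dots> \<longleftrightarrow> x \<in> S"
    proof
      assume avoid: "\<forall>(p, q)\<in>T. \<not> (p \<le> x \<and> x \<le> q)"
      show "x \<in> S"
      proof (rule ccontr)
        assume "x \<notin> S"
        obtain p q where pq: "sup_prime p" "inf_prime q" "p \<le> x" "x \<le> q" "S \<inter> {p..q} = {}"
          by (rule sublattice_complement_interval[OF assms \<open>x \<notin> S\<close>])
        then have "(p, q) \<in> T" by (simp add: T_def)
        with avoid pq(3,4) show False by auto
      qed
    next
      assume "x \<in> S"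
      then show "\<forall>(p, q)\<in>T. \<not> (p \<le> x \<and> x \<le> q)" by (auto simp: T_def)
    qed
    finally show ?thesis .
  qed
qed

lemma (in universe_of_separations) star_le_iff: "star r \<le> star s \<longleftrightarrow> s \<le> r"
  by (metis star_involution star_order_reversing)

text \<open>An order-reversing involution is an isomorphism onto the dual lattice, which gives de
  Morgan's laws.\<close>

lemma (in universe_of_separations) star_sup: "star (sup r s) = inf (star r) (star s)"
proof (rule antisym)
  show "inf (star r) (star s) \<le> star (sup r s)"
    by (metis inf_le1 inf_le2 le_supI star_involution star_order_reversing)
qed (simp add: star_le_iff)

lemma (in universe_of_separations) star_inf: "star (inf r s) = sup (star r) (star s)"
  by (metis star_involution star_sup)

theorem theorem5p4:
  fixes star :: "'a::{finite, distrib_lattice} \<Rightarrow> 'a"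
    and U' :: "'a set"
  assumes "universe_of_separations star"
    and "subuniverse star U'"
  shows "\<exists>(f :: 'a \<Rightarrow> real) (k :: real).
           submodular_order_function star f \<and> 0 \<le> k \<and> U' = f -` {0..k}"
proof -
  interpret universe_of_separations star by fact
  obtain g :: "'a \<Rightarrow> real" where g: "\<And>x. 0 \<le> g x"
    "\<And>r s. g (sup r s) + g (inf r s) \<le> g r + g s" "\<And>x. g x = 0 \<longleftrightarrow> x \<in> U'"
    using submodular_vanishing_on_sublattice[of U'] assms(2) unfolding subuniverse_def by metis
  define f where "f x = g x + g (star x)" for x
  \<comment> \<open>By de Morgan, \<open>star\<close> merely swaps the two terms on the left of the
    inequality, so composing \<open>g\<close> with it preserves submodularity.\<close>
  have "f (sup r s) + f (inf r s) \<le> f r + f s" for r s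
    using g(2)[of r s] g(2)[of "star r" "star s"] by (simp add: f_def star_sup star_inf)
  then have "submodular_order_function star f"
    using g(1) by (simp add: submodular_order_function_def f_def star_involution)
  \<comment> \<open>Both summands of \<open>f\<close> are nonnegative, so \<open>f\<close> vanishes
    only where \<open>g\<close> does; conversely, on \<open>U'\<close> the second summand vanishes
    because \<open>U'\<close> is closed under \<open>star\<close>.\<close>
  moreover have "x \<in> U' \<longleftrightarrow> f x \<in> {0..0}" for x
    using g(1)[of x] g(1)[of "star x"] g(3)[of x] g(3)[of "star x"] assms(2)
    by (auto simp: f_def subuniverse_def add_nonneg_eq_0_iff)
  then have "U' = f -` {0..0}"
    by blast
  ultimately show ?thesis
    by (intro exI[of _ f] exI[of _ 0]) simp
qed

end
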